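(* Let $(q^2;q)_\infty=\prod_{i\geq 2}(1-q^i)=\sum_{j\geq 0}a_jq^j$ be the power series expansion. Then this power series is of Bloch--Pólya type. Furthermore, for any $j\in\mathbb{Z}_{\geq 0}$ there exists a unique $n\in\mathbb{Z}_{\geq 0}$ such that $p_2(2n)\leq j<p_2(2n+2)$, and for this $n$ $$a_j=\begin{cases}1,&\text{if } p_2(2n)\leq j<p_1(2n+1),\\ -1,&\text{if } p_2(2n+1)\leq j<p_1(2n+2),\\ 0,&\text{otherwise.}\end{cases}$$
   Context: A polynomial (or power series) in $q$ is said to be of Bloch--Pólya type if all of its coefficients belong to the set $\{-1,0,1\}$. For integers $n\geq 0$, $p_1(n)=\frac{n(3n-1)}{2}$ and $p_2(n)=\frac{n(3n+1)}{2}$ (the two families of pentagonal numbers). The product $(q^2;q)_\infty=\prod_{i\geq 2}(1-q^i)$ is regarded as a power series in $q$ (convergent for $|q|<1$). *)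

theory Defs
  imports "HOL-Analysis.Analysis" "HOL-Computational_Algebra.Formal_Power_Series"
begin

text \<open>
  The infinite \<open>q\<close>-Pochhammer symbol \<open>(a; q)\<^sub>\<infinity>\<close>. On formal power series the limit is taken in
  the \<open>X\<close>-adic metric of the library.
\<close>
definition qpochhammer_inf :: "'a \<Rightarrow> 'a \<Rightarrow> 'a :: {t2_space, comm_ring_1}" where
  "qpochhammer_inf a q = (\<Prod>k. 1 - a * q ^ k)"

definition bloch_polya :: "'a :: ring_1 fps \<Rightarrow> bool" where
  "bloch_polya F \<longleftrightarrow> (\<forall>j. fps_nth F j \<in> {-1, 0, 1})"

text \<open>
  Both numerators are even, and the truncated subtraction is harmless at \<open>n = 0\<close>, where the
  factor \<open>n\<close> vanishes.
\<close>
definition p1 :: "nat \<Rightarrow> nat" where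
  "p1 n = n * (3 * n - 1) div 2"

definition p2 :: "nat \<Rightarrow> nat" where
  "p2 n = n * (3 * n + 1) div 2"

end

theory Submission
  imports Defs
begin

text \<open>
  Shanks' finite form of Euler's pentagonal number theorem writes
  \<open>\<Sum>\<bar>s\<bar> \<le> n. (-1)^s q^(s(3s+1)/2)\<close> as
  \<open>\<Sum>s\<le>n. (-1)^s (1 - q^(s+1)) \<cdots> (1 - q^n) q^(s n + s(s+1)/2)\<close>.
  Its term \<open>s = 0\<close> is \<open>(1 - q) \<cdots> (1 - q^n)\<close> and all others are divisible by \<open>q^(n+1)\<close>. Grouping the
  pentagonal sum as \<open>\<Sum>k\<le>n. (-1)^k (q^(p2 k) - q^(p1 (k+1)))\<close> up to a term of high order,
  each bracket is \<open>1 - q\<close> times a block of consecutive powers, and \<open>1 - q\<close> can be cancelled.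
\<close>

lemma two_p2: "2 * p2 n = n * (3 * n + 1)"
  unfolding p2_def by simp

text \<open>With \<open>p2_Suc\<close>, this replaces division and truncated subtraction by additive
  recurrences.\<close>

lemma p1_Suc: "p1 (Suc n) = p2 n + 2 * n + 1"
proof -
  have "Suc n * (3 * Suc n - 1) = 2 * (p2 n + 2 * n + 1)"
    using two_p2[of n] by (simp add: algebra_simps)
  then show ?thesis unfolding p1_def by simp
qed

lemma p2_Suc: "p2 (Suc n) = p1 (Suc n) + Suc n"
  using two_p2[of "Suc n"] two_p2[of n] p1_Suc[of n] by (simp add: algebra_simps)

lemma p2_0 [simp]: "p2 0 = 0"
  by (simp add: p2_def)

text \<open>Identifies the exponent of Shanks' last term, \<open>s = n\<close>, as a pentagonal
  number.\<close>

lemma p2_eq_square_plus_triangle: "p2 n = n * n + \<Sum>{..n}"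
  by (induction n) (simp_all add: p2_Suc p1_Suc)

lemma strict_mono_p2: "strict_mono p2"
  by (rule strict_mono_Suc_iff[THEN iffD2]) (simp add: p2_Suc p1_Suc)

lemma le_p2: "n \<le> p2 n"
  using strict_mono_p2 by (rule strict_mono_imp_increasing)

text \<open>Induction on \<open>n\<close>: the termwise differences of consecutive left sides
  telescope in \<open>s\<close>, and only two boundary powers survive, the new pentagonal
  ones.\<close>

lemma shanks_identity:
  fixes q :: "'a :: comm_ring_1"
  shows "(\<Sum>s\<le>n. (-1) ^ s * (\<Prod>i\<in>{s<..n}. 1 - q ^ i) * q ^ (s * n + \<Sum>{..s}))
       = 1 + (\<Sum>s<n. (-1) ^ Suc s * (q ^ p1 (Suc s) + q ^ p2 (Suc s)))"
proof (induction n)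
  case 0
  show ?case by simp
next
  case (Suc n)
  define P where "P s = (\<Prod>i\<in>{s<..n}. 1 - q ^ i)" for s
  define t where "t m s = (-1) ^ s * (\<Prod>i\<in>{s<..m}. 1 - q ^ i) * q ^ (s * m + \<Sum>{..s})" for m s
  \<comment> \<open>Up to sign, the closed form of the partial sums of differences. Its exponent is
    that of \<open>t n (Suc s)\<close>, so the two can be combined.\<close>
  define A where "A s = (-1) ^ s * P s * q ^ (s * n + \<Sum>{..s} + s + n + 1)" for s
  have t_n: "t n s = (-1) ^ s * P s * q ^ (s * n + \<Sum>{..s})" for s
    by (simp add: t_def P_def)
  have t_Suc: "t (Suc n) s = (-1) ^ s * P s * (1 - q ^ Suc n) * q ^ (s * n + \<Sum>{..s} + s)"
    if "s \<le> n" for s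
  proof -
    have "{s<..Suc n} = insert (Suc n) {s<..n}" using that by auto
    then show ?thesis by (simp add: t_def P_def algebra_simps)
  qed
  have P_step: "P s = (1 - q ^ Suc s) * P (Suc s)" if "s < n" for s
  proof -
    have "{s<..n} = insert (Suc s) {Suc s<..n}" using that by auto
    then show ?thesis by (simp add: P_def)
  qed
  have telescope: "(\<Sum>s\<le>m. t (Suc n) s - t n s) = - A m" if "m \<le> n" for m
    using that
  proof (induction m)
    case 0
    then show ?case by (simp add: t_Suc t_n A_def algebra_simps)
  next
    case (Suc m)
    then have "(\<Sum>s\<le>Suc m. t (Suc n) s - t n s) = - A m + (t (Suc n) (Suc m) - t n (Suc m))"
      by simp
    \<comment> \<open>After \<open>P_step\<close> the common factor multiplies
      \<open>(1 - q^(m+1)) + (1 - q^(n+1)) q^(m+1) - 1\<close>, which is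
      \<open>- q^(m+n+2)\<close>.\<close>
    also have "\<dots> = - A (Suc m)"
      using Suc.prems unfolding A_def t_n t_Suc[OF Suc.prems] P_step[OF Suc_le_lessD[OF Suc.prems]]
      by (simp add: algebra_simps power_add)
    finally show ?case .
  qed
  have "n * n + \<Sum>{..n} + n + n + 1 = p1 (Suc n)"
    by (simp add: p1_Suc p2_eq_square_plus_triangle)
  then have A_n: "A n = (-1) ^ n * q ^ p1 (Suc n)"
    by (simp only: A_def) (simp add: P_def)
  have t_last: "t (Suc n) (Suc n) = (-1) ^ Suc n * q ^ p2 (Suc n)"
    by (simp only: t_def p2_eq_square_plus_triangle) simp
  have "(\<Sum>s\<le>Suc n. t (Suc n) s)
      = (\<Sum>s\<le>n. t n s) + (\<Sum>s\<le>n. t (Suc n) s - t n s) + t (Suc n) (Suc n)"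
    by (simp add: sum_subtractf)
  also have "\<dots> = (\<Sum>s\<le>n. t n s) + (-1) ^ Suc n * (q ^ p1 (Suc n) + q ^ p2 (Suc n))"
    unfolding telescope[OF order.refl] A_n t_last by (simp add: algebra_simps)
  finally show ?case
    using Suc.IH by (simp add: t_def)
qed

text \<open>Multiplying by \<open>1 - q\<close> leaves only the two ends of each block. Pairing the
  upper end of block \<open>k\<close> with the lower end of block \<open>k + 1\<close> leaves the
  last upper end single, hence the correction term.\<close>

lemma pentagonal_blocks:
  fixes q :: "'a :: comm_ring_1"
  shows "(1 - q) * (\<Sum>k\<le>n. (-1) ^ k * (\<Sum>j\<in>{p2 k..<p1 (Suc k)}. q ^ j))
       = 1 + (\<Sum>s<n. (-1) ^ Suc s * (q ^ p1 (Suc s) + q ^ p2 (Suc s))) - (-1) ^ n * q ^ p1 (Suc n)"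
proof -
  have block: "(1 - q) * (\<Sum>j\<in>{a..<b}. q ^ j) = q ^ a - q ^ b" if "a \<le> b" for a b :: nat
    using that
  proof (induction b rule: dec_induct)
    case (step m)
    then have "(1 - q) * (\<Sum>j\<in>{a..<Suc m}. q ^ j) = (q ^ a - q ^ m) + (1 - q) * q ^ m"
      by (simp only: sum.atLeastLessThan_Suc distrib_left)
    then show ?case by (simp add: algebra_simps)
  qed simp
  have *: "(1 - q) * ((-1) ^ k * (\<Sum>j\<in>{p2 k..<p1 (Suc k)}. q ^ j))
      = (-1) ^ k * (q ^ p2 k - q ^ p1 (Suc k))" for k
    by (subst mult.left_commute, subst block) (simp_all add: p1_Suc)
  have "(1 - q) * (\<Sum>k\<le>n. (-1) ^ k * (\<Sum>j\<in>{p2 k..<p1 (Suc k)}. q ^ j))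
      = (\<Sum>k\<le>n. (-1) ^ k * (q ^ p2 k - q ^ p1 (Suc k)))"
    by (subst sum_distrib_left) (simp only: *)
  also have "\<dots> = 1 + (\<Sum>s<n. (-1) ^ Suc s * (q ^ p1 (Suc s) + q ^ p2 (Suc s)))
      - (-1) ^ n * q ^ p1 (Suc n)"
    by (induction n) (simp_all add: algebra_simps)
  finally show ?thesis .
qed

text \<open>The bound \<open>k \<le> j\<close> loses nothing since \<open>k \<le> p2 k\<close>; it
  makes the coefficient of the infinite block series a finite sum that does not depend on a
  truncation.\<close>

definition pentagonal_block_coeff :: "nat \<Rightarrow> int" where
  "pentagonal_block_coeff j = (\<Sum>k\<le>j. if p2 k \<le> j \<and> j < p1 (Suc k) then (-1) ^ k else 0)"

lemma fps_nth_pentagonal_blocks: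
  assumes "j \<le> n"
  shows "fps_nth (\<Sum>k\<le>n. (-1) ^ k * (\<Sum>i\<in>{p2 k..<p1 (Suc k)}. fps_X ^ i)) j
       = pentagonal_block_coeff j"
proof -
  \<comment> \<open>As constant series, the signs can be pulled out of
    \<open>fps_nth\<close>.\<close>
  have sign: "(-1) ^ k * F = fps_const ((-1) ^ k) * F" for k and F :: "int fps"
    by (cases "even k") (simp_all flip: fps_const_neg)
  have "fps_nth (\<Sum>k\<le>n. (-1) ^ k * (\<Sum>i\<in>{p2 k..<p1 (Suc k)}. fps_X ^ i)) j
      = (\<Sum>k\<le>n. if p2 k \<le> j \<and> j < p1 (Suc k) then (-1) ^ k else (0::int))"
    by (auto simp: fps_sum_nth sign intro!: sum.cong)
  also have "\<dots> = pentagonal_block_coeff j"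
    unfolding pentagonal_block_coeff_def
  proof (rule sum.mono_neutral_right)
    show "\<forall>k\<in>{..n} - {..j}. (if p2 k \<le> j \<and> j < p1 (Suc k) then (-1) ^ k else (0::int)) = 0"
      by (auto dest: order.trans[OF le_p2])
  qed (use assms in auto)
  finally show ?thesis .
qed

text \<open>\<open>1 - fps_X\<close> is a unit; its inverse is the geometric series.\<close>

lemma fps_one_minus_X_dvd_cancel:
  fixes F G :: "'a :: comm_ring_1 fps"
  assumes "F dvd (1 - fps_X) * G"
  shows "F dvd G"
proof -
  have "Abs_fps (\<lambda>_. 1) * (1 - fps_X) = (1 :: 'a fps)"
    by (rule fps_ext) (simp add: algebra_simps)
  then have "G = Abs_fps (\<lambda>_. 1) * ((1 - fps_X) * G)"
    by (metis mult.assoc mult_1)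
  then show ?thesis
    using assms by (metis dvd_mult)
qed

lemma fps_nth_eqI_dvd:
  fixes F G :: "'a :: comm_ring_1 fps"
  assumes "fps_X ^ m dvd F - G" "j < m"
  shows "fps_nth F j = fps_nth G j"
proof -
  obtain R where "F - G = fps_X ^ m * R" using assms(1) by (rule dvdE)
  then have "fps_nth (F - G) j = 0"
    using assms(2) by (simp add: fps_X_power_mult_nth)
  then show ?thesis by simp
qed

lemma fps_nth_partial_product:
  assumes "j \<le> n"
  shows "fps_nth (\<Prod>i\<in>{1<..n}. 1 - fps_X ^ i) j = pentagonal_block_coeff j"
\<comment> \<open>For \<open>n = 0\<close> the product over \<open>{0<..n}\<close> is empty, so no
  factor \<open>1 - fps_X\<close> can be split off.\<close>
proof (cases "n = 0")
  case True
  then show ?thesis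
    using assms by (simp add: pentagonal_block_coeff_def p1_Suc)
next
  case False
  define B :: "int fps"
    where "B = (\<Sum>k\<le>n. (-1) ^ k * (\<Sum>i\<in>{p2 k..<p1 (Suc k)}. fps_X ^ i))"
  define Q :: "int fps" where "Q = (\<Prod>i\<in>{1<..n}. 1 - fps_X ^ i)"
  define rest :: "int fps" where
    "rest = (\<Sum>s\<in>{1..n}. (-1) ^ s * (\<Prod>i\<in>{s<..n}. 1 - fps_X ^ i) * fps_X ^ (s * n + \<Sum>{..s}))"
  have "{0<..n} = insert 1 {1<..n}" using False by auto
  then have zeroth: "(\<Prod>i\<in>{0<..n}. 1 - fps_X ^ i) = (1 - fps_X) * Q"
    by (simp add: Q_def)
  have "{..n} = insert 0 {1..n}" by auto
  then have "(\<Sum>s\<le>n. (-1) ^ s * (\<Prod>i\<in>{s<..n}. 1 - fps_X ^ i) * fps_X ^ (s * n + \<Sum>{..s}))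
      = (1 - fps_X) * Q + rest"
    by (simp add: rest_def zeroth)
  then have "(1 - fps_X) * (Q - B) = (-1) ^ n * fps_X ^ p1 (Suc n) - rest"
    unfolding right_diff_distrib B_def pentagonal_blocks shanks_identity by simp
  moreover have "fps_X ^ Suc n dvd rest"
    unfolding rest_def
  \<comment> \<open>For \<open>s \<ge> 1\<close> the exponent is at least
    \<open>n + s\<close>.\<close>
  proof (intro dvd_sum dvd_mult le_imp_power_dvd)
    fix s assume s: "s \<in> {1..n}"
    then have "n \<le> s * n" by simp
    moreover have "s \<le> \<Sum>{..s}" by (rule member_le_sum) auto
    ultimately show "Suc n \<le> s * n + \<Sum>{..s}"
      using s unfolding atLeastAtMost_iff by linarith
  qed
  moreover have "fps_X ^ Suc n dvd (-1) ^ n * (fps_X ^ p1 (Suc n) :: int fps)"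
    by (intro dvd_mult le_imp_power_dvd) (simp add: p1_Suc)
  ultimately have "fps_X ^ Suc n dvd Q - B"
    by (metis dvd_diff fps_one_minus_X_dvd_cancel)
  then have "fps_nth Q j = fps_nth B j"
    by (rule fps_nth_eqI_dvd) (use assms in simp)
  then show ?thesis
    using assms by (simp add: Q_def B_def fps_nth_pentagonal_blocks)
qed

lemma has_prod_pentagonal_block_coeff:
  "(\<lambda>i. 1 - fps_X ^ (i + 2)) has_prod Abs_fps pentagonal_block_coeff"
proof -
  have shift: "(\<Prod>i\<le>n. 1 - fps_X ^ (i + 2)) = (\<Prod>i\<in>{1<..n + 2}. 1 - fps_X ^ i :: int fps)" for n
    by (rule prod.reindex_bij_witness[of _ "\<lambda>i. i - 2" "\<lambda>i. i + 2"]) auto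
  have "(\<lambda>n. \<Prod>i\<le>n. 1 - fps_X ^ (i + 2)) \<longlonglongrightarrow> Abs_fps pentagonal_block_coeff"
  proof (rule tendsto_fpsI)
    fix j
    show "\<forall>\<^sub>F n in sequentially. fps_nth (\<Prod>i\<le>n. 1 - fps_X ^ (i + 2)) j
        = fps_nth (Abs_fps pentagonal_block_coeff) j"
      using eventually_ge_at_top[of j]
      by eventually_elim (simp only: shift fps_nth_partial_product trans_le_add1 fps_nth_Abs_fps)
  qed
  \<comment> \<open>\<open>raw_has_prod\<close> also demands a nonzero limit; here the constant
    coefficient is 1.\<close>
  moreover have "fps_nth (Abs_fps pentagonal_block_coeff) 0 \<noteq> 0"
    by (simp add: pentagonal_block_coeff_def p1_Suc)
  then have "Abs_fps pentagonal_block_coeff \<noteq> 0"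
    by (metis fps_zero_nth)
  ultimately show ?thesis
    by (simp add: has_prod_def raw_has_prod_def)
qed

text \<open>Blocks before \<open>2 * n\<close> end below \<open>p2 (2 * n)\<close> and blocks from
  \<open>2 * n + 2\<close> on start above \<open>j\<close>, so two blocks of opposite sign
  remain.\<close>

lemma pentagonal_block_coeff_eq:
  assumes "p2 (2 * n) \<le> j" "j < p2 (2 * n + 2)"
  shows "pentagonal_block_coeff j =
    (if p2 (2 * n) \<le> j \<and> j < p1 (2 * n + 1) then 1
     else if p2 (2 * n + 1) \<le> j \<and> j < p1 (2 * n + 2) then - 1
     else 0)"
proof -
  define g :: "nat \<Rightarrow> int" where
    "g k = (if p2 k \<le> j \<and> j < p1 (Suc k) then (-1) ^ k else 0)" for k
  have "g k = 0" if "k \<notin> {2 * n, 2 * n + 1}" for k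
  proof (cases "k < 2 * n")
    case True
    then have "p2 (Suc k) \<le> p2 (2 * n)"
      using strict_mono_p2 by (simp add: strict_mono_less_eq)
    then show ?thesis
      using assms by (simp add: g_def p2_Suc)
  next
    case False
    then have "p2 (2 * n + 2) \<le> p2 k"
      using that strict_mono_p2 by (simp add: strict_mono_less_eq)
    then show ?thesis
      using assms by (simp add: g_def)
  qed
  moreover have "g k = 0" if "k > j" for k
    using that le_p2[of k] by (simp add: g_def)
  ultimately have "sum g {..j} = sum g {2 * n, 2 * n + 1}"
    by (intro sum.mono_neutral_cong) (auto simp: not_le)
  \<comment> \<open>The two remaining blocks are disjoint, so their sum is a case
    distinction.\<close>
  moreover have "p1 (2 * n + 1) \<le> p2 (2 * n + 1)"
    using p2_Suc[of "2 * n"] by simp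
  ultimately show ?thesis
    by (auto simp: pentagonal_block_coeff_def g_def)
qed

lemma ex1_p2_interval: "\<exists>!n. p2 (2 * n) \<le> j \<and> j < p2 (2 * n + 2)"
proof (rule ex_ex1I)
  have "\<exists>k. j < p2 (2 * k)"
    using le_p2[of "2 * Suc j"] by (intro exI[of _ "Suc j"]) simp
  then have least: "j < p2 (2 * (LEAST k. j < p2 (2 * k)))"
    by (rule LeastI_ex)
  \<comment> \<open>The least \<open>k\<close> is positive because \<open>p2 0 = 0\<close>; its
    predecessor is the witness.\<close>
  then obtain n where n: "(LEAST k. j < p2 (2 * k)) = Suc n"
    by (cases "LEAST k. j < p2 (2 * k)") auto
  then have "\<not> j < p2 (2 * n)"
    by (metis lessI not_less_Least)
  then show "\<exists>n. p2 (2 * n) \<le> j \<and> j < p2 (2 * n + 2)"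
    using least n by (intro exI[of _ n]) simp
next
  fix m n
  assume "p2 (2 * m) \<le> j \<and> j < p2 (2 * m + 2)" "p2 (2 * n) \<le> j \<and> j < p2 (2 * n + 2)"
  \<comment> \<open>Crossing the bounds gives \<open>m < n + 1\<close> and
    \<open>n < m + 1\<close>.\<close>
  then have "p2 (2 * m) < p2 (2 * n + 2)" "p2 (2 * n) < p2 (2 * m + 2)"
    by auto
  then show "m = n"
    using strict_mono_p2 by (simp add: strict_mono_less)
qed

text \<open>The infinite product operator is a definite description, which has a value even without
  convergence; the \<open>has_prod\<close> conjunct certifies that the expansion is a genuine
  limit.\<close>

theorem theorem2p2:
  fixes a :: "nat \<Rightarrow> int"
  assumes expansion: "qpochhammer_inf (fps_X ^ 2) fps_X = Abs_fps a"
  shows "(\<lambda>i. 1 - fps_X ^ (i + 2)) has_prod Abs_fps a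
    \<and> bloch_polya (Abs_fps a)
    \<and> (\<forall>j. (\<exists>!n. p2 (2 * n) \<le> j \<and> j < p2 (2 * n + 2))
          \<and> (\<forall>n. p2 (2 * n) \<le> j \<and> j < p2 (2 * n + 2) \<longrightarrow>
               a j = (if p2 (2 * n) \<le> j \<and> j < p1 (2 * n + 1) then 1
                      else if p2 (2 * n + 1) \<le> j \<and> j < p1 (2 * n + 2) then - 1
                      else 0)))"
proof -
  have "qpochhammer_inf (fps_X ^ 2) fps_X = (\<Prod>i. 1 - fps_X ^ (i + 2) :: int fps)"
    unfolding qpochhammer_inf_def by (simp only: flip: power_add) (simp only: add.commute)
  also have "\<dots> = Abs_fps pentagonal_block_coeff"
    using has_prod_unique[OF has_prod_pentagonal_block_coeff] by simp
  finally have "Abs_fps a = Abs_fps pentagonal_block_coeff"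
    using expansion by simp
  then have a: "a = pentagonal_block_coeff"
    by (metis fps_nth_Abs_fps ext)
  have "pentagonal_block_coeff j \<in> {-1, 0, 1}" for j
  proof -
    obtain n where "p2 (2 * n) \<le> j" "j < p2 (2 * n + 2)"
      using ex1_p2_interval by blast
    then show ?thesis
      by (simp only: pentagonal_block_coeff_eq) simp
  qed
  then have "bloch_polya (Abs_fps pentagonal_block_coeff)"
    by (simp add: bloch_polya_def)
  then show ?thesis
    unfolding a
    using has_prod_pentagonal_block_coeff ex1_p2_interval pentagonal_block_coeff_eq by blast
qed

end
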